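(* Let $G$ be a finite group and $l$ a prime number. Then the restriction map $f\mapsto f|_{G[l^{\infty}]}$ from $\widehat{G}[l^{\infty}]$ to $\widehat{G[l^{\infty}]}$ is an isomorphism of groups.
   Context: A semicharacter of a finite group $G$ is a function $f:G\to\mathbb{C}^{*}$ satisfying $f(ab)=f(a)f(b)$ for all pairs of commuting elements $a,b\in G$. The set $\widehat{G}$ of all semicharacters of $G$ is an abelian group under pointwise multiplication (finite whenever $G$ is finite). For a group $H$ and a prime $l$, $H[l^{\infty}]$ denotes the set of elements of $H$ whose order is a power of $l$ (including the identity); it is a subgroup if $H$ is abelian. Thus $\widehat{G}[l^{\infty}]$ is the subgroup of elements of $l$-power order in the abelian group $\widehat{G}$. On the other hand, $\widehat{G[l^{\infty}]}$ denotes the group, under pointwise multiplication, of maps $f:G[l^{\infty}]\to\mathbb{C}^{*}$ such that $f(xy)=f(x)f(y)$ whenever $x,y\in G[l^{\infty}]$ commute (in that case $xy\in G[l^{\infty}]$ as well). *)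

theory Defs
  imports Complex_Main "HOL-Computational_Algebra.Primes" "HOL-Algebra.Multiplicative_Group"
begin

(* H[l^inf]: group.ord is 0 on elements of infinite order, so these are excluded; k = 0 gives
   the identity. *)
definition primary_part :: "('a, 'b) monoid_scheme \<Rightarrow> nat \<Rightarrow> 'a set" where
  "primary_part H l = {x \<in> carrier H. \<exists>k. group.ord H x = l ^ k}"

(* The group of semicharacters on a subset S of G. Maps S -> C^* are represented by functions that
   are undefined outside S, so that equality in the carrier is equality of maps on S.
   This is meant for sets S that are closed under products of commuting elements, such as
   carrier G and primary_part G l. *)
definition semichar_group_on ::
    "('a, 'b) monoid_scheme \<Rightarrow> 'a set \<Rightarrow> ('a \<Rightarrow> complex) monoid" where
  "semichar_group_on G S =
     \<lparr>carrier = {f \<in> S \<rightarrow>\<^sub>E (UNIV - {0}).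
                  \<forall>a\<in>S. \<forall>b\<in>S. a \<otimes>\<^bsub>G\<^esub> b = b \<otimes>\<^bsub>G\<^esub> a \<longrightarrow> f (a \<otimes>\<^bsub>G\<^esub> b) = f a * f b},
      mult = (\<lambda>f g. \<lambda>x\<in>S. f x * g x),
      one = (\<lambda>x\<in>S. 1)\<rparr>"

abbreviation semichar_group :: "('a, 'b) monoid_scheme \<Rightarrow> ('a \<Rightarrow> complex) monoid" where
  "semichar_group G \<equiv> semichar_group_on G (carrier G)"

lemma comm_group_semichar_group_on:
  assumes closed: "\<And>a b. \<lbrakk>a \<in> S; b \<in> S; a \<otimes>\<^bsub>G\<^esub> b = b \<otimes>\<^bsub>G\<^esub> a\<rbrakk> \<Longrightarrow> a \<otimes>\<^bsub>G\<^esub> b \<in> S"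
  shows "comm_group (semichar_group_on G S)"
proof (rule comm_groupI)
  fix f assume f: "f \<in> carrier (semichar_group_on G S)"
  let ?g = "\<lambda>x\<in>S. inverse (f x)"
  have "?g \<in> carrier (semichar_group_on G S)"
    using f closed by (auto simp: semichar_group_on_def PiE_iff)
  moreover have "?g \<otimes>\<^bsub>semichar_group_on G S\<^esub> f = \<one>\<^bsub>semichar_group_on G S\<^esub>"
    using f by (auto simp: semichar_group_on_def PiE_iff fun_eq_iff restrict_def)
  ultimately show "\<exists>g\<in>carrier (semichar_group_on G S).
      g \<otimes>\<^bsub>semichar_group_on G S\<^esub> f = \<one>\<^bsub>semichar_group_on G S\<^esub>"
    by blast
qed (use closed in \<open>auto simp: semichar_group_on_def PiE_iff fun_eq_iff restrict_def extensional_def\<close>)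

lemma (in group) comm_group_semichar_group: "comm_group (semichar_group G)"
  by (rule comm_group_semichar_group_on) auto

lemma (in group) primary_part_iff:
  assumes "prime (l::nat)"
  shows "x \<in> primary_part G l \<longleftrightarrow> x \<in> carrier G \<and> (\<exists>k. x [^] (l ^ k) = \<one>)"
  unfolding primary_part_def
  using assms by (simp add: pow_eq_id divides_primepow_nat cong: conj_cong) blast

lemma (in group) primary_part_mult_closed:
  assumes l: "prime (l::nat)" and xy: "x \<in> primary_part G l" "y \<in> primary_part G l"
    and comm: "x \<otimes> y = y \<otimes> x"
  shows "x \<otimes> y \<in> primary_part G l"
proof -
  obtain i j where carr: "x \<in> carrier G" "y \<in> carrier G"
    and ij: "x [^] (l ^ i) = \<one>" "y [^] (l ^ j) = \<one>"
    using xy primary_part_iff[OF l] by blast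
  have "x [^] (l ^ (i + j)) = \<one>" "y [^] (l ^ (i + j)) = \<one>"
    using carr ij by (simp_all add: pow_eq_id power_add)
  hence "(x \<otimes> y) [^] (l ^ (i + j)) = \<one>"
    using carr by (simp add: pow_mult_distrib[OF comm])
  thus ?thesis
    using carr primary_part_iff[OF l] by blast
qed

lemma (in group) comm_group_semichar_group_on_primary_part:
  "prime (l::nat) \<Longrightarrow> comm_group (semichar_group_on G (primary_part G l))"
  by (intro comm_group_semichar_group_on primary_part_mult_closed)

lemma (in comm_group) subgroup_primary_part:
  assumes l: "prime (l::nat)"
  shows "subgroup (primary_part G l) G"
proof (rule subgroupI)
  show "primary_part G l \<noteq> {}"
    using primary_part_iff[OF l, of \<one>] by auto
  show "inv a \<in> primary_part G l" if "a \<in> primary_part G l" for a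
    using that by (auto simp: primary_part_def)
  show "a \<otimes> b \<in> primary_part G l" if "a \<in> primary_part G l" "b \<in> primary_part G l" for a b
    using that by (intro primary_part_mult_closed[OF l])
      (auto simp: primary_part_def m_comm)
qed (auto simp: primary_part_def)

end

theory Submission
  imports Defs
begin

text \<open>Write \<open>|G| = l^a * m\<close> with \<open>l\<close> not dividing \<open>m\<close>, and choose \<open>N\<close> divisible by \<open>m\<close> and congruent to 1
modulo \<open>l^(a + 1)\<close>. The map \<open>x \<mapsto> x^N\<close> is a retraction of \<open>G\<close> onto \<open>G[l^\<infinity>]\<close> that is
multiplicative on commuting pairs, so \<open>g \<mapsto> (x \<mapsto> g (x^N))\<close> extends semicharacters from
\<open>G[l^\<infinity>]\<close> to \<open>G\<close>, and the extensions have order dividing \<open>l^a\<close>. Conversely, the restriction of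
\<open>f\<close> determines \<open>f(x)^N = f(x^N)\<close>, and on \<open>l\<close>-power roots of unity raising to the power \<open>N\<close> is injective.\<close>

lemma pow_semichar_group_on:
  "f [^]\<^bsub>semichar_group_on G S\<^esub> (n::nat) = (\<lambda>x\<in>S. f x ^ n)"
  by (induction n) (auto simp: semichar_group_on_def fun_eq_iff restrict_def)

text \<open>Powers of \<open>x\<close> commute with \<open>x\<close>, so multiplicativity on
  commuting pairs suffices for induction; the base case cancels the nonzero value in
  \<open>f \<one> = f \<one> * f \<one>\<close>. The set \<open>S\<close> is general so as to cover
  both \<open>carrier G\<close> and \<open>primary_part G l\<close>.\<close>

lemma (in group) semichar_pow:
  assumes f: "f \<in> carrier (semichar_group_on G S)" and S: "S \<subseteq> carrier G" and x: "x \<in> S"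
    and pow: "\<And>n::nat. x [^] n \<in> S"
  shows "f (x [^] (n::nat)) = f x ^ n"
proof -
  have one: "\<one> \<in> S" using pow[of 0] by simp
  have xc: "x \<in> carrier G" using x S by blast
  have mult: "f (a \<otimes> b) = f a * f b" if "a \<in> S" "b \<in> S" "a \<otimes> b = b \<otimes> a" for a b
    using f that by (auto simp: semichar_group_on_def)
  have "f \<one> \<noteq> 0" using f one by (auto simp: semichar_group_on_def PiE_iff)
  hence "f \<one> = 1" using mult[OF one one] by simp
  thus ?thesis
  proof (induction n)
    case (Suc n)
    have "x [^] n \<otimes> x = x \<otimes> x [^] n" using xc nat_pow_comm[of x n 1] by simp
    thus ?case using Suc mult[OF pow x] by simp
  qed simp
qed

lemma (in group) primary_part_pow_closed:
  assumes l: "prime (l::nat)" and x: "x \<in> primary_part G l"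
  shows "x [^] (n::nat) \<in> primary_part G l"
proof -
  obtain k where xc: "x \<in> carrier G" and k: "x [^] (l ^ k) = \<one>"
    using x primary_part_iff[OF l] by blast
  have "(x [^] n) [^] (l ^ k) = (x [^] (l ^ k)) [^] n"
    using xc by (simp add: nat_pow_pow mult.commute)
  thus ?thesis using xc k primary_part_iff[OF l] by auto
qed

lemma (in group) ex_primary_projection_exponent:
  assumes fin: "finite (carrier G)" and l: "prime (l::nat)"
  obtains N a :: nat where
    "coprime N l"
    "\<And>x. x \<in> primary_part G l \<Longrightarrow> x [^] N = x"
    "\<And>x. x \<in> carrier G \<Longrightarrow> (x [^] N) [^] (l ^ a) = \<one>"
proof -
  have "order G \<noteq> 0" using fin order_gt_0_iff_finite by simp
  then obtain a m where om: "order G = l ^ a * m" and m: "\<not> l dvd m"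
    using multiplicity_decompose'[of "order G" l] l by (metis not_prime_unit)
  \<comment> \<open>The exponent is \<open>Suc a\<close> so that even for \<open>a = 0\<close> the
    modulus is not 1, as Bezout over the naturals requires, and is divisible by \<open>l\<close>,
    which makes \<open>N = m * u\<close> prime to \<open>l\<close>.\<close>
  have "coprime m (l ^ Suc a)"
    using l m by (simp add: prime_imp_coprime coprime_commute)
  moreover have "l ^ Suc a \<noteq> 1"
    using l by (metis nat_power_eq_Suc_0_iff One_nat_def nat.distinct(1) not_prime_1)
  ultimately obtain u v where uv: "m * u = l ^ Suc a * v + 1"
    using coprime_bezout_strong by blast
  have id: "x [^] (m * u) = x" if x: "x \<in> primary_part G l" for x
  proof -
    obtain k where xc: "x \<in> carrier G" and k: "ord x = l ^ k"
      using x by (auto simp: primary_part_def)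
    \<comment> \<open>The order of \<open>x\<close> is a power of \<open>l\<close> dividing the
      group order, hence divides \<open>l ^ a\<close>; so \<open>x [^] N\<close> depends only on
      \<open>N\<close> modulo \<open>l ^ Suc a\<close>, where \<open>N\<close> is 1.\<close>
    have "l ^ k dvd l ^ a * m" using ord_dvd_group_order[OF xc] k om by simp
    moreover have "coprime (l ^ k) m" using l m by (simp add: prime_imp_coprime)
    ultimately have "l ^ k dvd l ^ a" by (simp add: coprime_dvd_mult_left_iff)
    hence "ord x dvd l ^ Suc a * v" using k by simp
    hence "x [^] (l ^ Suc a * v) = \<one>" using xc by (simp only: pow_eq_id)
    thus ?thesis using xc by (simp add: uv)
  qed
  have proj: "(x [^] (m * u)) [^] (l ^ a) = \<one>" if x: "x \<in> carrier G" for x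
  proof -
    have "(x [^] (m * u)) [^] (l ^ a) = x [^] (order G * u)"
      using x by (simp add: nat_pow_pow om ac_simps)
    moreover have "ord x dvd order G * u" using ord_dvd_group_order[OF x] by simp
    ultimately show ?thesis using x by (simp only: pow_eq_id)
  qed
  have "\<not> l dvd m * u"
  proof
    assume "l dvd m * u"
    hence "l dvd l ^ Suc a * v + 1" by (simp only: uv)
    moreover have "l dvd l ^ Suc a * v" by simp
    ultimately have "l dvd 1" using dvd_add_right_iff by blast
    thus False using l not_prime_unit by blast
  qed
  hence "coprime (m * u) l"
    using l prime_imp_coprime coprime_commute by blast
  thus thesis using that id proj by blast
qed

text \<open>With \<open>m * u = n * v + 1\<close>, the equal powers \<open>z ^ (n * v)\<close> and
  \<open>w ^ (n * v)\<close> are nonzero and cancel from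
  \<open>z ^ (m * u) = w ^ (m * u)\<close>.\<close>

lemma power_eq_power_coprime_imp_eq:
  fixes z w :: "'a::field"
  assumes nz: "w \<noteq> 0" and cop: "coprime (m::nat) n"
    and m: "z ^ m = w ^ m" and n: "z ^ n = w ^ n"
  shows "z = w"
proof (cases "n = 1")
  case False
  then obtain u v where uv: "m * u = n * v + 1"
    using coprime_bezout_strong[OF cop] by blast
  have "z ^ (m * u) = w ^ (m * u)" using m by (simp add: power_mult)
  moreover have "z ^ (n * v) = w ^ (n * v)" using n by (simp add: power_mult)
  ultimately show ?thesis using nz by (simp add: uv)
qed (use n in simp)

theorem lemma2p6:
  fixes G (structure) and l :: nat
  assumes "group G" and "finite (carrier G)" and "prime l"
  shows "(\<lambda>f. restrict f (primary_part G l)) \<in>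
    iso ((semichar_group G)\<lparr>carrier := primary_part (semichar_group G) l\<rparr>)
        (semichar_group_on G (primary_part G l))"
proof -
  interpret group G by fact
  interpret C: comm_group "semichar_group G" by (rule comm_group_semichar_group)
  note l = \<open>prime l\<close>
  let ?P = "primary_part G l" and ?\<rho> = "\<lambda>f::'a \<Rightarrow> complex. restrict f (primary_part G l)"
  let ?A = "primary_part (semichar_group G) l"
  let ?B = "carrier (semichar_group_on G ?P)"
  have PG: "?P \<subseteq> carrier G" by (auto simp: primary_part_def)
  obtain N a :: nat where N: "coprime N l"
    and id: "\<And>x. x \<in> ?P \<Longrightarrow> x [^] N = x"
    and proj: "\<And>x. x \<in> carrier G \<Longrightarrow> (x [^] N) [^] (l ^ a) = \<one>"
    using ex_primary_projection_exponent[OF assms(2) l] by blast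
  have NP: "x [^] N \<in> ?P" if "x \<in> carrier G" for x
    using that proj primary_part_iff[OF l] by blast
  \<comment> \<open>Powers of semicharacters are pointwise, so \<open>l\<close>-power order means
    that one exponent \<open>l ^ k\<close> kills all values at once.\<close>
  have A_iff: "f \<in> ?A \<longleftrightarrow> f \<in> carrier (semichar_group G) \<and>
      (\<exists>k. \<forall>x\<in>carrier G. f x ^ (l ^ k) = 1)" for f
    unfolding C.primary_part_iff[OF l] pow_semichar_group_on
    by (auto simp: semichar_group_on_def fun_eq_iff restrict_def)
  have into: "?\<rho> f \<in> ?B" if "f \<in> ?A" for f
  proof -
    have "f \<in> carrier (semichar_group G)" using that A_iff by blast
    thus ?thesis
      using PG primary_part_mult_closed[OF l]
      by (auto simp: semichar_group_on_def PiE_iff subset_iff)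
  qed
  have inj: "inj_on ?\<rho> ?A"
  proof (rule inj_onI)
    fix f g assume f: "f \<in> ?A" and g: "g \<in> ?A" and eq: "?\<rho> f = ?\<rho> g"
    have fc: "f \<in> carrier (semichar_group G)" and gc: "g \<in> carrier (semichar_group G)"
      using f g A_iff by blast+
    obtain i j where i: "\<And>x. x \<in> carrier G \<Longrightarrow> f x ^ (l ^ i) = 1"
      and j: "\<And>x. x \<in> carrier G \<Longrightarrow> g x ^ (l ^ j) = 1"
      using f g A_iff by blast
    have "f x = g x" if x: "x \<in> carrier G" for x
    proof (rule power_eq_power_coprime_imp_eq)
      show "g x \<noteq> 0" using gc x by (auto simp: semichar_group_on_def PiE_iff)
      \<comment> \<open>\<open>l ^ (i + j)\<close> kills the values of both \<open>f\<close> and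
        \<open>g\<close>, whose orders may differ.\<close>
      show "coprime N (l ^ (i + j))" using N by simp
      have "f (x [^] N) = g (x [^] N)" using eq NP[OF x] by (metis restrict_apply')
      thus "f x ^ N = g x ^ N"
        using semichar_pow[OF fc order_refl x] semichar_pow[OF gc order_refl x] x by simp
      show "f x ^ (l ^ (i + j)) = g x ^ (l ^ (i + j))"
        using power_mult[of "f x" "l ^ i" "l ^ j"] power_mult[of "g x" "l ^ j" "l ^ i"]
          i[OF x] j[OF x] by (simp add: power_add mult.commute)
    qed
    moreover have "f \<in> extensional (carrier G)" "g \<in> extensional (carrier G)"
      using fc gc by (auto simp: semichar_group_on_def PiE_iff)
    ultimately show "f = g" by (metis extensionalityI)
  qed
  have surj: "?B \<subseteq> ?\<rho> ` ?A"
  proof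
    fix g assume g: "g \<in> ?B"
    let ?h = "\<lambda>x\<in>carrier G. g (x [^] N)"
    have gmult: "g (x \<otimes> y) = g x * g y" if "x \<in> ?P" "y \<in> ?P" "x \<otimes> y = y \<otimes> x" for x y
      using g that by (auto simp: semichar_group_on_def)
    have gpow: "g (x [^] n) = g x ^ n" if "x \<in> ?P" for x and n :: nat
      using semichar_pow[OF g PG that primary_part_pow_closed[OF l that]] .
    have one: "\<one> \<in> ?P" using primary_part_iff[OF l, of \<one>] by simp
    have gone: "g \<one> = 1" using gpow[OF one, of 0] by simp
    have hmult: "g ((x \<otimes> y) [^] N) = g (x [^] N) * g (y [^] N)"
      if "x \<in> carrier G" "y \<in> carrier G" "x \<otimes> y = y \<otimes> x" for x y
    proof -
      have xy: "(x \<otimes> y) [^] N = x [^] N \<otimes> y [^] N"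
        using pow_mult_distrib that by blast
      \<comment> \<open>Expanding the same power in both orders shows that \<open>x [^] N\<close>
        and \<open>y [^] N\<close> commute, so that \<open>gmult\<close> applies to them.\<close>
      have "(y \<otimes> x) [^] N = y [^] N \<otimes> x [^] N"
        using pow_mult_distrib that by metis
      with xy that(3) have "x [^] N \<otimes> y [^] N = y [^] N \<otimes> x [^] N" by metis
      thus ?thesis using gmult NP that(1,2) xy by metis
    qed
    have "?h \<in> carrier (semichar_group G)"
      using g NP hmult by (auto simp: semichar_group_on_def PiE_iff)
    \<comment> \<open>The exponent \<open>l ^ a\<close> kills every \<open>x [^] N\<close>, hence
      every value of \<open>?h\<close>, uniformly in \<open>x\<close>.\<close>
    moreover have "\<forall>x\<in>carrier G. ?h x ^ (l ^ a) = 1"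
      using gpow[OF NP, of _ "l ^ a"] proj gone by simp
    ultimately have "?h \<in> ?A" using A_iff by blast
    moreover have "?\<rho> ?h = g"
    proof (rule extensionalityI[of _ ?P])
      show "g \<in> extensional ?P" using g by (auto simp: semichar_group_on_def PiE_iff)
    qed (use PG id in auto)
    ultimately show "g \<in> ?\<rho> ` ?A" by (metis image_eqI)
  qed
  have "bij_betw ?\<rho> ?A ?B"
    using inj into surj by (auto simp: bij_betw_def)
  moreover have "?\<rho> (f \<otimes>\<^bsub>semichar_group G\<^esub> g) = ?\<rho> f \<otimes>\<^bsub>semichar_group_on G ?P\<^esub> ?\<rho> g" for f g
    using PG by (auto simp: semichar_group_on_def fun_eq_iff restrict_def)
  ultimately show ?thesis
    using into by (auto simp: iso_def hom_def)
qed

end
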